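(* Let $r_1,r_2,\rho_1,\rho_2$ be real parameters, let $$F(x)=\frac{(x-\rho_1)(x-\rho_2)}{2x},\qquad G(x)=\frac{(x-r_1+1/2)(x-r_2+1/2)}{2x+1},$$ and let $L=F(x)(I-R)+G(x)(T^+R-I)$. Then $L$ is symmetrizable for generic values of the parameters $r_1,r_2,\rho_1,\rho_2$. More precisely: (a) A real-valued function $\varphi(x)$ satisfies $(\varphi(x)L)^*=\varphi(x)L$ if and only if $$\varphi(-x)F(-x)=\varphi(x)F(x)\quad\text{and}\quad \varphi(-x-1)G(-x-1)=\varphi(x)G(x).$$ (b) A function $\varphi$ of the form $$\varphi(x)=-2\sigma_0(x)\,\frac{\Gamma(\rho_1-x)\,\Gamma(x-r_1+\frac12)\,\Gamma(-x-r_1+\frac12)\,\Gamma(x+1+\rho_1)}{\Gamma(x+1-\rho_2)\,\Gamma(x+r_2+\frac12)\,\Gamma(r_2+\frac12-x)\,\Gamma(-x-\rho_2)}$$ satisfies the two conditions in (a) if and only if $\sigma_0$ is 1-periodic, $\sigma_0(x+1)=\sigma_0(x)$, and odd, $\sigma_0(-x)=-\sigma_0(x)$. (c) Such a $\varphi$ can equivalently be presented as $$\varphi(x)=\sigma_2(x)\,\frac{\Gamma(\rho_1-x)\,\Gamma(\rho_1+1+x)\,\Gamma(\rho_2-x)\,\Gamma(1+\rho_2+x)}{\Gamma(r_2+\frac12+x)\,\Gamma(r_2+\frac12-x)\,\Gamma(r_1+\frac12+x)\,\Gamma(r_1+\frac12-x)},$$ where $\sigma_2$ is again 1-periodic and 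odd.
   Context: Operators act on functions of a real variable $x$: $Rf(x)=f(-x)$, $T^+f(x)=f(x+1)$, $T^-f(x)=f(x-1)$, $T^+Rf(x)=f(-x-1)$, and $I$ is the identity. The formal (Lagrange) adjoint is defined by $R^*=R$, $(T^+)^*=T^-$ (so that $(T^+R)^*=T^+R$), with multiplication operators self-adjoint and products reversed; thus the adjoint of $a(x)+b(x)R+c(x)T^+R$ is $a(x)+b(-x)R+c(-x-1)T^+R$. The operator $L$ is called symmetrizable if there exists a real-valued function $\varphi(x)$ (a symmetry factor) such that $(\varphi(x)L)^*=\varphi(x)L$. *)

theory Defs
  imports "HOL-Analysis.Analysis"
begin

text \<open>
  Operator expressions generated by the shifts, the reflection and the multiplication operators.
  The adjoint is formal: it is computed by recursion on the expression, whereas equality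
  of operators is equality of their actions on functions.
\<close>

datatype shift_op =
    OpI
  | OpR
  | OpTp
  | OpTm
  | OpMult "real \<Rightarrow> real"
  | OpAdd shift_op shift_op (infixl "\<oplus>" 65)
  | OpDiff shift_op shift_op (infixl "\<ominus>" 65)
  | OpComp shift_op shift_op (infixl "\<cdot>" 70)

primrec op_apply :: "shift_op \<Rightarrow> (real \<Rightarrow> real) \<Rightarrow> real \<Rightarrow> real" where
  "op_apply OpI f = f"
| "op_apply OpR f = (\<lambda>x. f (- x))"
| "op_apply OpTp f = (\<lambda>x. f (x + 1))"
| "op_apply OpTm f = (\<lambda>x. f (x - 1))"
| "op_apply (OpMult a) f = (\<lambda>x. a x * f x)"
| "op_apply (A \<oplus> B) f = (\<lambda>x. op_apply A f x + op_apply B f x)"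
| "op_apply (A \<ominus> B) f = (\<lambda>x. op_apply A f x - op_apply B f x)"
| "op_apply (A \<cdot> B) f = op_apply A (op_apply B f)"

primrec adjoint_op :: "shift_op \<Rightarrow> shift_op" where
  "adjoint_op OpI = OpI"
| "adjoint_op OpR = OpR"
| "adjoint_op OpTp = OpTm"
| "adjoint_op OpTm = OpTp"
| "adjoint_op (OpMult a) = OpMult a"
| "adjoint_op (A \<oplus> B) = adjoint_op A \<oplus> adjoint_op B"
| "adjoint_op (A \<ominus> B) = adjoint_op A \<ominus> adjoint_op B"
| "adjoint_op (A \<cdot> B) = adjoint_op B \<cdot> adjoint_op A"

lemma op_apply_TpR: "op_apply (OpTp \<cdot> OpR) f x = f (- x - 1)"
  by simp

lemma op_apply_adjoint_three_term:
  "op_apply (adjoint_op (OpMult a \<oplus> OpMult b \<cdot> OpR \<oplus> OpMult c \<cdot> (OpTp \<cdot> OpR))) f x =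
   op_apply (OpMult a \<oplus> OpMult (\<lambda>x. b (- x)) \<cdot> OpR \<oplus>
     OpMult (\<lambda>x. c (- x - 1)) \<cdot> (OpTp \<cdot> OpR)) f x"
  by simp

text \<open>
  The coefficients and symmetry factors have poles, so identities are considered on
  subsets of the real line that are stable under the reflection and the unit shifts
  (stability under \<open>x \<mapsto> x - 1 = - ((- x) + 1)\<close> is implied).
\<close>

definition invariant_domain :: "real set \<Rightarrow> bool" where
  "invariant_domain D \<longleftrightarrow> (\<forall>x\<in>D. - x \<in> D \<and> x + 1 \<in> D)"

definition op_eq_on :: "real set \<Rightarrow> shift_op \<Rightarrow> shift_op \<Rightarrow> bool" where
  "op_eq_on D A B \<longleftrightarrow> (\<forall>f. \<forall>x\<in>D. op_apply A f x = op_apply B f x)"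

definition symmetry_factor_on :: "real set \<Rightarrow> shift_op \<Rightarrow> (real \<Rightarrow> real) \<Rightarrow> bool" where
  "symmetry_factor_on D L \<phi> \<longleftrightarrow> op_eq_on D (adjoint_op (OpMult \<phi> \<cdot> L)) (OpMult \<phi> \<cdot> L)"

text \<open>
  Without the nonvanishing condition every operator would be symmetrizable by the zero function.
  The points excluded from the domain form a closed discrete set.
\<close>

definition symmetrizable :: "shift_op \<Rightarrow> bool" where
  "symmetrizable L \<longleftrightarrow>
     (\<exists>D \<phi>. invariant_domain D \<and> (\<forall>\<^sub>\<approx>x\<in>UNIV. x \<in> D) \<and>
        (\<forall>x\<in>D. \<phi> x \<noteq> 0) \<and> symmetry_factor_on D L \<phi>)"

definition coeffF :: "real \<Rightarrow> real \<Rightarrow> real \<Rightarrow> real" where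
  "coeffF \<rho>1 \<rho>2 x = (x - \<rho>1) * (x - \<rho>2) / (2 * x)"

definition coeffG :: "real \<Rightarrow> real \<Rightarrow> real \<Rightarrow> real" where
  "coeffG r1 r2 x = (x - r1 + 1/2) * (x - r2 + 1/2) / (2 * x + 1)"

definition opL :: "real \<Rightarrow> real \<Rightarrow> real \<Rightarrow> real \<Rightarrow> shift_op" where
  "opL r1 r2 \<rho>1 \<rho>2 =
     OpMult (coeffF \<rho>1 \<rho>2) \<cdot> (OpI \<ominus> OpR) \<oplus>
     OpMult (coeffG r1 r2) \<cdot> (OpTp \<cdot> OpR \<ominus> OpI)"

definition symmetry_conditions_on ::
  "real set \<Rightarrow> (real \<Rightarrow> real) \<Rightarrow> (real \<Rightarrow> real) \<Rightarrow> (real \<Rightarrow> real) \<Rightarrow> bool" where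
  "symmetry_conditions_on D F G \<phi> \<longleftrightarrow>
     (\<forall>x\<in>D. \<phi> (- x) * F (- x) = \<phi> x * F x \<and>
             \<phi> (- x - 1) * G (- x - 1) = \<phi> x * G x)"

definition periodic_odd_on :: "real set \<Rightarrow> (real \<Rightarrow> real) \<Rightarrow> bool" where
  "periodic_odd_on D \<sigma> \<longleftrightarrow> (\<forall>x\<in>D. \<sigma> (x + 1) = \<sigma> x \<and> \<sigma> (- x) = - \<sigma> x)"

text \<open>
  The points whose orbit under \<open>x \<mapsto> - x\<close> and \<open>x \<mapsto> x + 1\<close> contains no
  zero or pole of \<open>F\<close> or \<open>G\<close>; none of the Gamma functions below has a pole there.
\<close>

definition regular_points :: "real \<Rightarrow> real \<Rightarrow> real \<Rightarrow> real \<Rightarrow> real set" where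
  "regular_points r1 r2 \<rho>1 \<rho>2 =
     {x. 2 * x \<notin> \<int> \<and>
         (\<forall>c\<in>{\<rho>1, \<rho>2, r1 - 1/2, r2 - 1/2}. x - c \<notin> \<int> \<and> x + c \<notin> \<int>)}"

definition gamma_weight0 :: "real \<Rightarrow> real \<Rightarrow> real \<Rightarrow> real \<Rightarrow> (real \<Rightarrow> real) \<Rightarrow> real \<Rightarrow> real" where
  "gamma_weight0 r1 r2 \<rho>1 \<rho>2 \<sigma> x =
     - 2 * \<sigma> x *
     ((Gamma (\<rho>1 - x) * Gamma (x - r1 + 1/2) * Gamma (- x - r1 + 1/2) * Gamma (x + 1 + \<rho>1)) /
      (Gamma (x + 1 - \<rho>2) * Gamma (x + r2 + 1/2) * Gamma (r2 + 1/2 - x) * Gamma (- x - \<rho>2)))"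

definition gamma_weight2 :: "real \<Rightarrow> real \<Rightarrow> real \<Rightarrow> real \<Rightarrow> (real \<Rightarrow> real) \<Rightarrow> real \<Rightarrow> real" where
  "gamma_weight2 r1 r2 \<rho>1 \<rho>2 \<sigma> x =
     \<sigma> x *
     ((Gamma (\<rho>1 - x) * Gamma (\<rho>1 + 1 + x) * Gamma (\<rho>2 - x) * Gamma (1 + \<rho>2 + x)) /
      (Gamma (r2 + 1/2 + x) * Gamma (r2 + 1/2 - x) * Gamma (r1 + 1/2 + x) * Gamma (r1 + 1/2 - x)))"

lemma invariant_domain_regular_points: "invariant_domain (regular_points r1 r2 \<rho>1 \<rho>2)"
proof -
  have neg: "- x \<in> regular_points r1 r2 \<rho>1 \<rho>2" if "x \<in> regular_points r1 r2 \<rho>1 \<rho>2" for x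
  proof -
    have eqs: "- x - c = - (x + c)" "- x + c = - (x - c)" "2 * (- x) = - (2 * x)" for c
      by simp_all
    have "- x - c \<in> \<int> \<longleftrightarrow> x + c \<in> \<int>" "- x + c \<in> \<int> \<longleftrightarrow> x - c \<in> \<int>"
      "2 * (- x) \<in> \<int> \<longleftrightarrow> 2 * x \<in> \<int>" for c
      unfolding eqs minus_in_Ints_iff by simp_all
    then show ?thesis
      using that by (auto simp only: regular_points_def mem_Collect_eq)
  qed
  have shift: "x + 1 \<in> regular_points r1 r2 \<rho>1 \<rho>2" if "x \<in> regular_points r1 r2 \<rho>1 \<rho>2" for x
  proof -
    have *: "y + of_int n \<in> \<int> \<longleftrightarrow> y \<in> \<int>" for y :: real and n
      by (metis Ints_add Ints_diff Ints_of_int add_diff_cancel_right')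
    have "x + 1 - c \<in> \<int> \<longleftrightarrow> x - c \<in> \<int>" "x + 1 + c \<in> \<int> \<longleftrightarrow> x + c \<in> \<int>" "2 * (x + 1) \<in> \<int> \<longleftrightarrow> 2 * x \<in> \<int>" for c
      using *[of "x - c" 1] *[of "x + c" 1] *[of "2 * x" 2] by (simp_all add: algebra_simps)
    then show ?thesis
      using that by (auto simp only: regular_points_def mem_Collect_eq)
  qed
  show ?thesis
    using neg shift by (auto simp: invariant_domain_def)
qed

lemma eventually_regular_points: "\<forall>\<^sub>\<approx>x\<in>UNIV. x \<in> regular_points r1 r2 \<rho>1 \<rho>2"
proof -
  have ev: "\<forall>\<^sub>\<approx>x\<in>UNIV. k * x - c \<notin> \<int>" if k: "k \<ge> 1" for k c :: real
  proof -
    have "\<not> z islimpt {x. k * x - c \<in> \<int>}" for z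
    proof (rule discrete_imp_not_islimpt[of "1 / k"])
      show "1 / k > 0" using k by simp
      fix x y assume "x \<in> {x. k * x - c \<in> \<int>}" "y \<in> {x. k * x - c \<in> \<int>}" and d: "dist y x < 1 / k"
      then have "(k * y - c) - (k * x - c) \<in> \<int>" by (blast intro: Ints_diff)
      then have "k * (y - x) \<in> \<int>" by (simp add: algebra_simps)
      moreover have "\<bar>k * (y - x)\<bar> < 1"
        unfolding abs_mult using d k by (simp add: dist_real_def field_simps)
      ultimately have "k * (y - x) = 0" using Ints_nonzero_abs_less1 by blast
      then show "y = x" using k by simp
    qed
    then have "{x. k * x - c \<in> \<int>} sparse_in UNIV"
      unfolding sparse_in_def by blast
    then show ?thesis
      by (simp add: eventually_cosparse)
  qed
  have ev2: "\<forall>\<^sub>\<approx>x\<in>UNIV. x - c \<notin> \<int> \<and> x + c \<notin> \<int>" for c :: real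
    using eventually_conj[OF ev[of 1 c] ev[of 1 "- c"]] by simp
  have ev3: "\<forall>\<^sub>\<approx>x\<in>UNIV. 2 * x \<notin> (\<int> :: real set)"
    using ev[of 2 0] by simp
  show ?thesis
    unfolding regular_points_def mem_Collect_eq
    by (intro eventually_conj[OF ev3] eventually_ball_finite ballI ev2) simp
qed

end

theory Submission
  imports Defs
begin

text \<open>
  Everything hinges on the two involutions \<open>x \<mapsto> - x\<close> and \<open>x \<mapsto> - x - 1\<close>. Taking the adjoint of
  \<open>\<phi> L\<close> leaves its multiplication part alone and carries the coefficients of \<open>R\<close> and \<open>T\<^sup>+ R\<close> along
  the corresponding involution. Since \<open>- x\<close> and \<open>- x - 1\<close> are different points, a test function can
  be concentrated at either one, so the two coefficients must agree separately; this is (a)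
  (lemma \<open>symmetry_factor_iff_conditions\<close>).

  The denominators \<open>2 x\<close> and \<open>2 x + 1\<close> change sign under the respective involutions. Hence a
  nowhere vanishing weight \<open>W\<close> for which the \<^emph>\<open>numerators\<close> of \<open>W F\<close> and \<open>W G\<close> are invariant turns
  the conditions on \<open>\<phi> = \<sigma> W\<close> into \<open>\<sigma> (- x) = - \<sigma> x\<close> and \<open>\<sigma> (- x - 1) = - \<sigma> x\<close>, that is, into
  oddness and 1-periodicity of \<open>\<sigma>\<close> (lemma \<open>antisymmetric_weight_conditions_iff\<close>). Such a weight can
  be assembled from one factor for each of the four roots of \<open>F\<close> and \<open>G\<close>: the factor for a root of
  \<open>F\<close> is invariant under \<open>x \<mapsto> - x - 1\<close> and absorbs its linear term under \<open>x \<mapsto> - x\<close>, and for a root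
  of \<open>G\<close> the involutions change roles. The functional equation of Gamma yields two choices of such a
  factor for each root; gamma products as in (b) and (c) are two ways of choosing.

  Part (c) then needs no reflection formula for Gamma: the symmetry conditions speak of \<open>\<phi>\<close> only, so
  dividing a given \<open>\<phi>\<close> by either weight leaves an odd 1-periodic function. Symmetrizability
  follows with \<open>\<sigma> x = sin (2 \<pi> x)\<close>, which vanishes only where \<open>2 x\<close> is an integer, that is, on the
  orbits of the poles \<open>0\<close> and \<open>- 1/2\<close> of \<open>F\<close> and \<open>G\<close>.
\<close>

section \<open>Symmetry factors as solutions of functional equations\<close>

text \<open>
  Only the values of the test function at \<open>- x\<close> and \<open>- x - 1\<close> survive in the difference of the two
  operators, with the defects of the two conditions as coefficients.
\<close>

lemma symmetry_factor_iff_conditions: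
  "symmetry_factor_on D (OpMult F \<cdot> (OpI \<ominus> OpR) \<oplus> OpMult G \<cdot> (OpTp \<cdot> OpR \<ominus> OpI)) \<phi> \<longleftrightarrow>
   symmetry_conditions_on D F G \<phi>"
proof -
  let ?L = "OpMult \<phi> \<cdot> (OpMult F \<cdot> (OpI \<ominus> OpR) \<oplus> OpMult G \<cdot> (OpTp \<cdot> OpR \<ominus> OpI))"
  have diff: "op_apply (adjoint_op ?L) f x = op_apply ?L f x \<longleftrightarrow>
      f (- x) * (\<phi> x * F x - \<phi> (- x) * F (- x)) +
      f (- x - 1) * (\<phi> (- x - 1) * G (- x - 1) - \<phi> x * G x) = 0" for f x
    by (simp add: algebra_simps)
  show ?thesis
  proof
    assume sym: "symmetry_factor_on D
      (OpMult F \<cdot> (OpI \<ominus> OpR) \<oplus> OpMult G \<cdot> (OpTp \<cdot> OpR \<ominus> OpI)) \<phi>"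
    have "\<phi> (- x) * F (- x) = \<phi> x * F x \<and> \<phi> (- x - 1) * G (- x - 1) = \<phi> x * G x"
      if "x \<in> D" for x
    proof -
      have eq: "f (- x) * (\<phi> x * F x - \<phi> (- x) * F (- x)) +
          f (- x - 1) * (\<phi> (- x - 1) * G (- x - 1) - \<phi> x * G x) = 0" for f
        using sym that diff unfolding symmetry_factor_on_def op_eq_on_def by blast
      \<comment> \<open>the first test function isolates the defect at \<open>- x\<close>, the second the one at \<open>- x - 1\<close>\<close>
      show ?thesis
        using eq[of "\<lambda>y. if y = - x then 1 else 0"] eq[of "\<lambda>y. if y = - x then 0 else 1"]
        by simp
    qed
    then show "symmetry_conditions_on D F G \<phi>"
      by (simp add: symmetry_conditions_on_def)
  next
    assume "symmetry_conditions_on D F G \<phi>"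
    then show "symmetry_factor_on D
      (OpMult F \<cdot> (OpI \<ominus> OpR) \<oplus> OpMult G \<cdot> (OpTp \<cdot> OpR \<ominus> OpI)) \<phi>"
      unfolding symmetry_factor_on_def op_eq_on_def diff symmetry_conditions_on_def by simp
  qed
qed

lemma invariant_domainD:
  assumes "invariant_domain D" "x \<in> D"
  shows "- x \<in> D" "x + 1 \<in> D" "- x - 1 \<in> D"
proof -
  show *: "- x \<in> D" "x + 1 \<in> D"
    using assms by (auto simp: invariant_domain_def)
  have "- (x + 1) \<in> D"
    using assms *(2) unfolding invariant_domain_def by blast
  then show "- x - 1 \<in> D" by simp
qed

lemma symmetry_conditions_on_cong:
  assumes "invariant_domain D" and "\<And>x. x \<in> D \<Longrightarrow> \<phi> x = \<psi> x"
  shows "symmetry_conditions_on D F G \<phi> \<longleftrightarrow> symmetry_conditions_on D F G \<psi>"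
  using assms invariant_domainD[OF assms(1)] by (simp add: symmetry_conditions_on_def)

definition antisymmetric_weight_on ::
  "real set \<Rightarrow> (real \<Rightarrow> real) \<Rightarrow> (real \<Rightarrow> real) \<Rightarrow> (real \<Rightarrow> real) \<Rightarrow> bool" where
  "antisymmetric_weight_on D F G W \<longleftrightarrow>
     (\<forall>x\<in>D. W x \<noteq> 0 \<and> F x \<noteq> 0 \<and> G x \<noteq> 0 \<and>
        W (- x) * F (- x) = - (W x * F x) \<and>
        W (- x - 1) * G (- x - 1) = - (W x * G x))"

text \<open>
  Multiplying by \<open>\<sigma>\<close> must repair the two signs. The resulting pair of equations is equivalent to
  oddness and periodicity because the involutions compose to the unit shift.
\<close>

lemma antisymmetric_weight_conditions_iff:
  assumes inv: "invariant_domain D" and W: "antisymmetric_weight_on D F G W"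
  shows "symmetry_conditions_on D F G (\<lambda>x. \<sigma> x * W x) \<longleftrightarrow> periodic_odd_on D \<sigma>"
proof -
  have cancel: "s * w' = t * w \<longleftrightarrow> s = - t" if "w' = - w" "w \<noteq> 0" for s t w w' :: real
  proof -
    have "s * w' = t * w \<longleftrightarrow> (- s) * w = t * w"
      using that(1) by simp
    also have "\<dots> \<longleftrightarrow> - s = t"
      using that(2) by (simp only: mult_cancel_right) simp
    finally show ?thesis by auto
  qed
  have "symmetry_conditions_on D F G (\<lambda>x. \<sigma> x * W x) \<longleftrightarrow>
      (\<forall>x\<in>D. \<sigma> (- x) = - \<sigma> x \<and> \<sigma> (- x - 1) = - \<sigma> x)"
    unfolding symmetry_conditions_on_def mult.assoc
    using W unfolding antisymmetric_weight_on_def by (intro ball_cong refl conj_cong cancel) auto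
  also have "\<dots> \<longleftrightarrow> periodic_odd_on D \<sigma>"
  proof -
    have "\<sigma> (- x - 1) = - \<sigma> (x + 1)" if "x \<in> D" "\<forall>x\<in>D. \<sigma> (- x) = - \<sigma> x" for x
      using that invariant_domainD(2)[OF inv]
      by (metis minus_add_distrib uminus_add_conv_diff add.commute)
    then show ?thesis
      unfolding periodic_odd_on_def by (smt (verit))
  qed
  finally show ?thesis .
qed

text \<open>
  The conditions do not mention how \<open>\<phi>\<close> is written, so a presentation over one weight can be
  exchanged for one over any other weight.
\<close>

lemma antisymmetric_weight_presentation_iff:
  assumes inv: "invariant_domain D" and W: "antisymmetric_weight_on D F G W"
  shows "(\<exists>\<sigma>. periodic_odd_on D \<sigma> \<and> (\<forall>x\<in>D. \<phi> x = \<sigma> x * W x)) \<longleftrightarrow>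
    symmetry_conditions_on D F G \<phi>"
proof
  assume "\<exists>\<sigma>. periodic_odd_on D \<sigma> \<and> (\<forall>x\<in>D. \<phi> x = \<sigma> x * W x)"
  then obtain \<sigma> where "periodic_odd_on D \<sigma>" "\<forall>x\<in>D. \<phi> x = \<sigma> x * W x"
    by blast
  then show "symmetry_conditions_on D F G \<phi>"
    using symmetry_conditions_on_cong[OF inv, of \<phi> "\<lambda>x. \<sigma> x * W x" F G]
      antisymmetric_weight_conditions_iff[OF inv W] by simp
next
  assume sym: "symmetry_conditions_on D F G \<phi>"
  have eq: "\<phi> x = \<phi> x / W x * W x" if "x \<in> D" for x
    using W that by (simp add: antisymmetric_weight_on_def)
  have "symmetry_conditions_on D F G (\<lambda>x. \<phi> x / W x * W x)"
    by (rule symmetry_conditions_on_cong[OF inv eq, THEN iffD1, OF _ sym])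
  then have odd: "periodic_odd_on D (\<lambda>x. \<phi> x / W x)"
    by (rule antisymmetric_weight_conditions_iff[OF inv W, THEN iffD1])
  show "\<exists>\<sigma>. periodic_odd_on D \<sigma> \<and> (\<forall>x\<in>D. \<phi> x = \<sigma> x * W x)"
  proof (rule exI, rule conjI)
    show "periodic_odd_on D (\<lambda>x. \<phi> x / W x)"
      by (rule odd)
    show "\<forall>x\<in>D. \<phi> x = \<phi> x / W x * W x"
      by (rule ballI) (rule eq)
  qed
qed

section \<open>Gamma factors attached to the roots of the coefficients\<close>

definition F_root_factor_on :: "real set \<Rightarrow> real \<Rightarrow> (real \<Rightarrow> real) \<Rightarrow> bool" where
  "F_root_factor_on D c u \<longleftrightarrow>
     (\<forall>x\<in>D. u x \<noteq> 0 \<and> u (- x) * (- x - c) = u x * (x - c) \<and> u (- x - 1) = u x)"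

definition G_root_factor_on :: "real set \<Rightarrow> real \<Rightarrow> (real \<Rightarrow> real) \<Rightarrow> bool" where
  "G_root_factor_on D c v \<longleftrightarrow>
     (\<forall>x\<in>D. v x \<noteq> 0 \<and> v (- x) = v x \<and> v (- x - 1) * (- x - 1 - c) = v x * (x - c))"

definition root_free :: "real set \<Rightarrow> real \<Rightarrow> bool" where
  "root_free D c \<longleftrightarrow> (\<forall>x\<in>D. x - c \<notin> \<int> \<and> x + c \<notin> \<int>)"

lemma Gamma_plus1_nonint:
  assumes "z \<notin> \<int>"
  shows "Gamma (z + 1) = z * Gamma (z :: real)" and "Gamma z \<noteq> 0"
  using assms Gamma_plus1[of z] Gamma_nonzero[of z] nonpos_Ints_Int by blast+

lemma root_free_Gamma_args:
  assumes "root_free D c" "x \<in> D"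
  shows "c - x \<notin> \<int>" "c + x \<notin> \<int>" "x - c \<notin> \<int>" "- x - c \<notin> \<int>"
proof -
  have *: "x - c \<notin> \<int>" "x + c \<notin> \<int>"
    using assms by (auto simp: root_free_def)
  have "c - x = - (x - c)" "- x - c = - (x + c)" "c + x = x + c"
    by simp_all
  then show "c - x \<notin> \<int>" "c + x \<notin> \<int>" "x - c \<notin> \<int>" "- x - c \<notin> \<int>"
    using * by (simp_all only: minus_in_Ints_iff not_False_eq_True)
qed

lemma Gamma_succ_args:
  assumes "root_free D c" "x \<in> D"
  shows "Gamma (c - x + 1) = (c - x) * Gamma (c - x)" "Gamma (c + x + 1) = (c + x) * Gamma (c + x)"
    "Gamma (x - c + 1) = (x - c) * Gamma (x - c)" "Gamma (- x - c + 1) = (- x - c) * Gamma (- x - c)"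
    "Gamma (c - x) \<noteq> 0" "Gamma (c + x) \<noteq> 0" "Gamma (x - c) \<noteq> 0" "Gamma (- x - c) \<noteq> 0"
    "c - x \<noteq> 0" "c + x \<noteq> 0" "x - c \<noteq> 0" "- x - c \<noteq> 0"
proof -
  note args = root_free_Gamma_args[OF assms]
  show "Gamma (c - x + 1) = (c - x) * Gamma (c - x)" "Gamma (c + x + 1) = (c + x) * Gamma (c + x)"
    "Gamma (x - c + 1) = (x - c) * Gamma (x - c)" "Gamma (- x - c + 1) = (- x - c) * Gamma (- x - c)"
    "Gamma (c - x) \<noteq> 0" "Gamma (c + x) \<noteq> 0" "Gamma (x - c) \<noteq> 0" "Gamma (- x - c) \<noteq> 0"
    using args[THEN Gamma_plus1_nonint(1)] args[THEN Gamma_plus1_nonint(2)] by blast+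
  show "c - x \<noteq> 0" "c + x \<noteq> 0" "x - c \<noteq> 0" "- x - c \<noteq> 0"
    using args Ints_0 by metis+
qed

text \<open>
  In this lemma and the next, \<open>x \<mapsto> - x - 1\<close> interchanges the arguments of the gamma product, and
  absorbing the linear term \<open>x - c\<close> by the functional equation moves one argument by 1, so that
  \<open>x \<mapsto> - x\<close> interchanges them instead.
\<close>

lemma F_root_factor_numerator:
  assumes "root_free D c"
  shows "F_root_factor_on D c (\<lambda>x. Gamma (c - x) * Gamma (c + x + 1))"
  unfolding F_root_factor_on_def
proof (intro ballI conjI)
  fix x assume x: "x \<in> D"
  note G = Gamma_succ_args[OF assms x]
  show "Gamma (c - x) * Gamma (c + x + 1) \<noteq> 0"
    using G by simp
  have "Gamma (c - - x) * Gamma (c + - x + 1) = (c - x) * (Gamma (c + x) * Gamma (c - x))"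
    using G(1) by (simp add: add.commute diff_add_eq)
  moreover have "b * (h * g) * (- x - c) = g * ((c + x) * h) * (x - c)" if "b = c - x" for b g h
    unfolding that by (simp add: algebra_simps)
  ultimately show "Gamma (c - - x) * Gamma (c + - x + 1) * (- x - c) =
      Gamma (c - x) * Gamma (c + x + 1) * (x - c)"
    unfolding G(2) by metis
  show "Gamma (c - (- x - 1)) * Gamma (c + (- x - 1) + 1) = Gamma (c - x) * Gamma (c + x + 1)"
    by (simp add: algebra_simps)
qed

lemma F_root_factor_denominator:
  assumes "root_free D c"
  shows "F_root_factor_on D c (\<lambda>x. 1 / (Gamma (x - c + 1) * Gamma (- x - c)))"
  unfolding F_root_factor_on_def
proof (intro ballI conjI)
  fix x assume x: "x \<in> D"
  note G = Gamma_succ_args[OF assms x]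
  show "1 / (Gamma (x - c + 1) * Gamma (- x - c)) \<noteq> 0"
    using G by simp
  have "Gamma (- x - c + 1) * Gamma (- (- x) - c) = (- x - c) * (Gamma (- x - c) * Gamma (x - c))"
    unfolding G(4) by simp
  moreover have "Gamma (x - c + 1) * Gamma (- x - c) = (x - c) * (Gamma (- x - c) * Gamma (x - c))"
    unfolding G(3) by simp
  moreover have "1 / (a * g) * a = 1 / (b * g) * b" if "a \<noteq> 0" "b \<noteq> 0" for a b g :: real
    using that by simp
  ultimately show "1 / (Gamma (- x - c + 1) * Gamma (- (- x) - c)) * (- x - c) =
      1 / (Gamma (x - c + 1) * Gamma (- x - c)) * (x - c)"
    using G(11,12) by metis
  have "- x - 1 - c + 1 = - x - c" "- (- x - 1) - c = x - c + 1"
    by simp_all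
  then show "1 / (Gamma (- x - 1 - c + 1) * Gamma (- (- x - 1) - c)) =
      1 / (Gamma (x - c + 1) * Gamma (- x - c))"
    by (simp only: mult.commute)
qed

text \<open>
  For the roots of \<open>G\<close> the mechanism is the same with the involutions exchanged: \<open>x \<mapsto> - x\<close> acts on
  the gamma product itself and \<open>x \<mapsto> - x - 1\<close> on the product that has absorbed the linear term.
\<close>

lemma G_root_factor_numerator:
  assumes "root_free D c"
  shows "G_root_factor_on D c (\<lambda>x. Gamma (x - c) * Gamma (- x - c))"
  unfolding G_root_factor_on_def
proof (intro ballI conjI)
  fix x assume x: "x \<in> D"
  note G = Gamma_succ_args[OF assms x]
  show "Gamma (x - c) * Gamma (- x - c) \<noteq> 0"
    using G by simp
  show "Gamma (- x - c) * Gamma (- (- x) - c) = Gamma (x - c) * Gamma (- x - c)"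
    by simp
  have "- x - 1 - c \<notin> \<int>"
    using root_free_Gamma_args(4)[OF assms x] Ints_add[of "- x - 1 - c" 1] by auto
  from Gamma_plus1_nonint(1)[OF this]
  have "Gamma (- x - c) = Gamma (- x - 1 - c) * (- x - 1 - c)"
    by (simp add: mult.commute)
  moreover have "Gamma (- (- x - 1) - c) = Gamma (x - c + 1)"
    by (simp add: algebra_simps)
  ultimately show "Gamma (- x - 1 - c) * Gamma (- (- x - 1) - c) * (- x - 1 - c) =
      Gamma (x - c) * Gamma (- x - c) * (x - c)"
    unfolding G(3) by simp
qed

lemma G_root_factor_denominator:
  assumes "root_free D c"
  shows "G_root_factor_on D c (\<lambda>x. 1 / (Gamma (c + x + 1) * Gamma (c - x + 1)))"
  unfolding G_root_factor_on_def
proof (intro ballI conjI)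
  fix x assume x: "x \<in> D"
  note G = Gamma_succ_args[OF assms x]
  show "1 / (Gamma (c + x + 1) * Gamma (c - x + 1)) \<noteq> 0"
    using G by simp
  show "1 / (Gamma (c + - x + 1) * Gamma (c - - x + 1)) = 1 / (Gamma (c + x + 1) * Gamma (c - x + 1))"
    by (simp add: mult.commute)
  have nonint: "c + x + 1 \<notin> \<int>"
    using root_free_Gamma_args(2)[OF assms x] Ints_diff[of "c + x + 1" 1] by auto
  then have nz: "c + x + 1 \<noteq> 0" "Gamma (c + x + 1) \<noteq> 0"
    using Ints_0 Gamma_plus1_nonint(2) by metis+
  have "Gamma (c - (- x - 1) + 1) = Gamma ((c + x + 1) + 1)"
    by (simp add: algebra_simps)
  also have "\<dots> = (c + x + 1) * Gamma (c + x + 1)"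
    by (rule Gamma_plus1_nonint(1)[OF nonint])
  finally have "Gamma (c - (- x - 1) + 1) = (c + x + 1) * Gamma (c + x + 1)" .
  moreover have "Gamma (c + (- x - 1) + 1) = Gamma (c - x)"
    by simp
  moreover have "- x - 1 - c = - (c + x + 1)" and "x - c = - (c - x)"
    by simp_all
  moreover have "1 / (g * (a * h)) * - a = 1 / (h * (b * g)) * - b"
    if "a \<noteq> 0" "b \<noteq> 0" for a b g h :: real
    using that by simp
  ultimately show "1 / (Gamma (c + (- x - 1) + 1) * Gamma (c - (- x - 1) + 1)) * (- x - 1 - c) =
      1 / (Gamma (c + x + 1) * Gamma (c - x + 1)) * (x - c)"
    unfolding G(1) using G(9) nz(1) by metis
qed

text \<open>
  The product of the four factors makes the numerators of \<open>W F\<close> and \<open>W G\<close> invariant, and the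
  denominators \<open>2 x\<close> and \<open>2 x + 1\<close> contribute the two minus signs.
\<close>

lemma antisymmetric_weight_product:
  fixes k :: real
  assumes D: "\<And>x. x \<in> D \<Longrightarrow> 2 * x \<notin> \<int>" and k: "k \<noteq> 0"
    and free: "root_free D \<rho>1" "root_free D \<rho>2" "root_free D (r1 - 1/2)" "root_free D (r2 - 1/2)"
    and u: "F_root_factor_on D \<rho>1 u1" "F_root_factor_on D \<rho>2 u2"
    and v: "G_root_factor_on D (r1 - 1/2) v1" "G_root_factor_on D (r2 - 1/2) v2"
  shows "antisymmetric_weight_on D (coeffF \<rho>1 \<rho>2) (coeffG r1 r2)
    (\<lambda>x. k * (u1 x * u2 x * v1 x * v2 x))"
  unfolding antisymmetric_weight_on_def
proof (intro ballI conjI)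
  fix x assume x: "x \<in> D"
  have "x \<noteq> 0" and "2 * x + 1 \<noteq> 0"
    using D[OF x] Ints_minus[of 1] by (auto simp: add_eq_0_iff2)
  note nz = Gamma_succ_args(11)[OF free(1) x] Gamma_succ_args(11)[OF free(2) x]
    Gamma_succ_args(11)[OF free(3) x] Gamma_succ_args(11)[OF free(4) x]
  have U: "u1 x \<noteq> 0" "u2 x \<noteq> 0" "u1 (- x - 1) = u1 x" "u2 (- x - 1) = u2 x"
    "u1 (- x) * (- x - \<rho>1) = u1 x * (x - \<rho>1)" "u2 (- x) * (- x - \<rho>2) = u2 x * (x - \<rho>2)"
    using u x by (auto simp only: F_root_factor_on_def)
  have V: "v1 x \<noteq> 0" "v2 x \<noteq> 0" "v1 (- x) = v1 x" "v2 (- x) = v2 x"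
    "v1 (- x - 1) * (- x - 1 - (r1 - 1/2)) = v1 x * (x - (r1 - 1/2))"
    "v2 (- x - 1) * (- x - 1 - (r2 - 1/2)) = v2 x * (x - (r2 - 1/2))"
    using v x by (auto simp only: G_root_factor_on_def)
  show "k * (u1 x * u2 x * v1 x * v2 x) \<noteq> 0"
    using U V k by simp
  show "coeffF \<rho>1 \<rho>2 x \<noteq> 0"
    using nz \<open>x \<noteq> 0\<close> by (simp add: coeffF_def)
  have G: "coeffG r1 r2 y = (y - (r1 - 1/2)) * (y - (r2 - 1/2)) / (2 * y + 1)" for y
    by (simp add: coeffG_def algebra_simps)
  show "coeffG r1 r2 x \<noteq> 0"
    unfolding G using nz \<open>2 * x + 1 \<noteq> 0\<close> by simp
  have "k * (u1 (- x) * u2 (- x) * v1 (- x) * v2 (- x)) * coeffF \<rho>1 \<rho>2 (- x) =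
      - (k * (u1 (- x) * (- x - \<rho>1)) * (u2 (- x) * (- x - \<rho>2)) * v1 (- x) * v2 (- x) / (2 * x))"
    by (simp add: coeffF_def)
  also have "\<dots> = - (k * (u1 x * u2 x * v1 x * v2 x) * coeffF \<rho>1 \<rho>2 x)"
    unfolding U(5,6) V(3,4) by (simp add: coeffF_def)
  finally show "k * (u1 (- x) * u2 (- x) * v1 (- x) * v2 (- x)) * coeffF \<rho>1 \<rho>2 (- x) =
      - (k * (u1 x * u2 x * v1 x * v2 x) * coeffF \<rho>1 \<rho>2 x)" .
  have "2 * (- x - 1) + 1 = - (2 * x + 1)"
    by simp
  then have "k * (u1 (- x - 1) * u2 (- x - 1) * v1 (- x - 1) * v2 (- x - 1)) *
        coeffG r1 r2 (- x - 1) =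
      - (k * (u1 (- x - 1) * u2 (- x - 1) * (v1 (- x - 1) * (- x - 1 - (r1 - 1/2))) *
        (v2 (- x - 1) * (- x - 1 - (r2 - 1/2)))) / (2 * x + 1))"
    unfolding G by (simp only: divide_minus_right mult_minus_right times_divide_eq_right mult_ac)
  also have "\<dots> = - (k * (u1 x * u2 x * v1 x * v2 x) * coeffG r1 r2 x)"
    unfolding U(3,4) V(5,6) G by (simp only: times_divide_eq_right mult_ac)
  finally show "k * (u1 (- x - 1) * u2 (- x - 1) * v1 (- x - 1) * v2 (- x - 1)) *
      coeffG r1 r2 (- x - 1) = - (k * (u1 x * u2 x * v1 x * v2 x) * coeffG r1 r2 x)" .
qed

section \<open>The two gamma weights\<close>

lemma regular_points_root_free:
  "root_free (regular_points r1 r2 \<rho>1 \<rho>2) \<rho>1" "root_free (regular_points r1 r2 \<rho>1 \<rho>2) \<rho>2"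
  "root_free (regular_points r1 r2 \<rho>1 \<rho>2) (r1 - 1/2)"
  "root_free (regular_points r1 r2 \<rho>1 \<rho>2) (r2 - 1/2)"
  unfolding root_free_def regular_points_def by blast+

lemma regular_points_double_nonint: "x \<in> regular_points r1 r2 \<rho>1 \<rho>2 \<Longrightarrow> 2 * x \<notin> \<int>"
  unfolding regular_points_def by blast

lemma gamma_weight0_antisymmetric:
  "antisymmetric_weight_on (regular_points r1 r2 \<rho>1 \<rho>2) (coeffF \<rho>1 \<rho>2) (coeffG r1 r2)
     (gamma_weight0 r1 r2 \<rho>1 \<rho>2 (\<lambda>_. 1))"
proof -
  note free = regular_points_root_free[of r1 r2 \<rho>1 \<rho>2]
  have eq: "gamma_weight0 r1 r2 \<rho>1 \<rho>2 (\<lambda>_. 1) = (\<lambda>x. - 2 *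
      ((Gamma (\<rho>1 - x) * Gamma (\<rho>1 + x + 1)) * (1 / (Gamma (x - \<rho>2 + 1) * Gamma (- x - \<rho>2))) *
       (Gamma (x - (r1 - 1/2)) * Gamma (- x - (r1 - 1/2))) *
       (1 / (Gamma ((r2 - 1/2) + x + 1) * Gamma ((r2 - 1/2) - x + 1)))))"
    by (simp add: gamma_weight0_def fun_eq_iff algebra_simps)
  show ?thesis
    unfolding eq
    by (rule antisymmetric_weight_product[OF regular_points_double_nonint _ free
          F_root_factor_numerator[OF free(1)] F_root_factor_denominator[OF free(2)]
          G_root_factor_numerator[OF free(3)] G_root_factor_denominator[OF free(4)]]) simp_all
qed

lemma gamma_weight2_antisymmetric:
  "antisymmetric_weight_on (regular_points r1 r2 \<rho>1 \<rho>2) (coeffF \<rho>1 \<rho>2) (coeffG r1 r2)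
     (gamma_weight2 r1 r2 \<rho>1 \<rho>2 (\<lambda>_. 1))"
proof -
  note free = regular_points_root_free[of r1 r2 \<rho>1 \<rho>2]
  have eq: "gamma_weight2 r1 r2 \<rho>1 \<rho>2 (\<lambda>_. 1) = (\<lambda>x. 1 *
      ((Gamma (\<rho>1 - x) * Gamma (\<rho>1 + x + 1)) * (Gamma (\<rho>2 - x) * Gamma (\<rho>2 + x + 1)) *
       (1 / (Gamma ((r1 - 1/2) + x + 1) * Gamma ((r1 - 1/2) - x + 1))) *
       (1 / (Gamma ((r2 - 1/2) + x + 1) * Gamma ((r2 - 1/2) - x + 1)))))"
    by (simp add: gamma_weight2_def fun_eq_iff algebra_simps)
  show ?thesis
    unfolding eq
    by (rule antisymmetric_weight_product[OF regular_points_double_nonint _ free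
          F_root_factor_numerator[OF free(1)] F_root_factor_numerator[OF free(2)]
          G_root_factor_denominator[OF free(3)] G_root_factor_denominator[OF free(4)]]) simp_all
qed

lemma gamma_weight_unit:
  "gamma_weight0 r1 r2 \<rho>1 \<rho>2 \<sigma> x = \<sigma> x * gamma_weight0 r1 r2 \<rho>1 \<rho>2 (\<lambda>_. 1) x"
  "gamma_weight2 r1 r2 \<rho>1 \<rho>2 \<sigma> x = \<sigma> x * gamma_weight2 r1 r2 \<rho>1 \<rho>2 (\<lambda>_. 1) x"
  by (simp_all add: gamma_weight0_def gamma_weight2_def)

lemma sin_2pi_periodic_odd: "periodic_odd_on D (\<lambda>x. sin (2 * pi * x))"
proof -
  have "2 * pi * (x + 1) = 2 * pi * x + 2 * pi" for x :: real
    by (simp add: algebra_simps)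
  then show ?thesis
    by (simp add: periodic_odd_on_def)
qed

lemma sin_2pi_nonzero:
  assumes "2 * x \<notin> \<int>"
  shows "sin (2 * pi * x) \<noteq> 0"
proof
  assume "sin (2 * pi * x) = 0"
  then obtain i where "2 * pi * x = of_int i * pi"
    using sin_zero_iff_int2 by blast
  then have "2 * x = of_int i"
    by simp
  then show False
    using assms by simp
qed

lemma symmetrizable_opL: "symmetrizable (opL r1 r2 \<rho>1 \<rho>2)"
proof -
  let ?D = "regular_points r1 r2 \<rho>1 \<rho>2" and ?W = "gamma_weight2 r1 r2 \<rho>1 \<rho>2 (\<lambda>_. 1)"
  let ?\<phi> = "\<lambda>x. sin (2 * pi * x) * ?W x"
  note inv = invariant_domain_regular_points[of r1 r2 \<rho>1 \<rho>2]
  note W = gamma_weight2_antisymmetric[of r1 r2 \<rho>1 \<rho>2]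
  have "\<forall>x\<in>?D. ?\<phi> x \<noteq> 0"
    using W sin_2pi_nonzero regular_points_double_nonint
    by (simp add: antisymmetric_weight_on_def)
  moreover have "symmetry_factor_on ?D (opL r1 r2 \<rho>1 \<rho>2) ?\<phi>"
    unfolding opL_def symmetry_factor_iff_conditions
      antisymmetric_weight_conditions_iff[OF inv W] by (rule sin_2pi_periodic_odd)
  ultimately show ?thesis
    unfolding symmetrizable_def using inv eventually_regular_points
    by (intro exI[of _ ?D] exI[of _ ?\<phi>] conjI)
qed

theorem mainTheorem9:
  fixes r1 r2 \<rho>1 \<rho>2 :: real
  shows "symmetrizable (opL r1 r2 \<rho>1 \<rho>2) \<and>
    (\<forall>D \<phi>. invariant_domain D \<longrightarrow>
       (symmetry_factor_on D (opL r1 r2 \<rho>1 \<rho>2) \<phi> \<longleftrightarrow>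
        symmetry_conditions_on D (coeffF \<rho>1 \<rho>2) (coeffG r1 r2) \<phi>)) \<and>
    (\<forall>\<sigma>0. symmetry_conditions_on (regular_points r1 r2 \<rho>1 \<rho>2) (coeffF \<rho>1 \<rho>2) (coeffG r1 r2)
             (gamma_weight0 r1 r2 \<rho>1 \<rho>2 \<sigma>0) \<longleftrightarrow>
           periodic_odd_on (regular_points r1 r2 \<rho>1 \<rho>2) \<sigma>0) \<and>
    (\<forall>\<phi>. (\<exists>\<sigma>0. periodic_odd_on (regular_points r1 r2 \<rho>1 \<rho>2) \<sigma>0 \<and>
             (\<forall>x\<in>regular_points r1 r2 \<rho>1 \<rho>2. \<phi> x = gamma_weight0 r1 r2 \<rho>1 \<rho>2 \<sigma>0 x)) \<longleftrightarrow>
          (\<exists>\<sigma>2. periodic_odd_on (regular_points r1 r2 \<rho>1 \<rho>2) \<sigma>2 \<and>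
             (\<forall>x\<in>regular_points r1 r2 \<rho>1 \<rho>2. \<phi> x = gamma_weight2 r1 r2 \<rho>1 \<rho>2 \<sigma>2 x)))"
proof (intro conjI allI impI)
  let ?D = "regular_points r1 r2 \<rho>1 \<rho>2"
  note inv = invariant_domain_regular_points[of r1 r2 \<rho>1 \<rho>2]
  note W0 = gamma_weight0_antisymmetric[of r1 r2 \<rho>1 \<rho>2]
  note W2 = gamma_weight2_antisymmetric[of r1 r2 \<rho>1 \<rho>2]
  show "symmetrizable (opL r1 r2 \<rho>1 \<rho>2)"
    by (rule symmetrizable_opL)
  show "symmetry_factor_on D (opL r1 r2 \<rho>1 \<rho>2) \<phi> \<longleftrightarrow>
      symmetry_conditions_on D (coeffF \<rho>1 \<rho>2) (coeffG r1 r2) \<phi>" for D \<phi>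
    unfolding opL_def by (rule symmetry_factor_iff_conditions)
  show "symmetry_conditions_on ?D (coeffF \<rho>1 \<rho>2) (coeffG r1 r2) (gamma_weight0 r1 r2 \<rho>1 \<rho>2 \<sigma>0) \<longleftrightarrow>
      periodic_odd_on ?D \<sigma>0" for \<sigma>0
    unfolding antisymmetric_weight_conditions_iff[OF inv W0, symmetric]
    by (simp add: gamma_weight_unit(1)[symmetric])
  show "(\<exists>\<sigma>0. periodic_odd_on ?D \<sigma>0 \<and> (\<forall>x\<in>?D. \<phi> x = gamma_weight0 r1 r2 \<rho>1 \<rho>2 \<sigma>0 x)) \<longleftrightarrow>
      (\<exists>\<sigma>2. periodic_odd_on ?D \<sigma>2 \<and> (\<forall>x\<in>?D. \<phi> x = gamma_weight2 r1 r2 \<rho>1 \<rho>2 \<sigma>2 x))" for \<phi>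
    using antisymmetric_weight_presentation_iff[OF inv W0, of \<phi>]
      antisymmetric_weight_presentation_iff[OF inv W2, of \<phi>]
    by (simp only: gamma_weight_unit[symmetric])
qed

end
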